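(* Let $\beta>1$ be a real number. Then the carry propagation of the language $L_\beta$ exists and is equal to $$\mathsf{CP}_\beta=\frac{\beta}{\beta-1}.$$
   Context: Let $\beta>1$ be real; $\lfloor x\rfloor$ and $\{x\}$ denote integer and fractional parts. The $\beta$-expansion of $1$ is the sequence $\mathrm{d}_\beta(1)=(t_n)_{n\ge1}$ given by $r_0=1$ and, for $i\ge1$, $t_i=\lfloor\beta r_{i-1}\rfloor$, $r_i=\{\beta r_{i-1}\}$. It is finite if it ends in infinitely many $0$'s, and is then written $t_1\cdots t_m$ with $t_m\neq0$. The quasi-greedy expansion of $1$ is $\mathrm{d}^*_\beta(1)=\mathrm{d}_\beta(1)$ if $\mathrm{d}_\beta(1)$ is infinite, and $\mathrm{d}^*_\beta(1)=(t_1\cdots t_{m-1}(t_m-1))^\omega$ if $\mathrm{d}_\beta(1)=t_1\cdots t_m$ is finite. Write $\mathrm{d}^*_\beta(1)=(d_i)_{i\ge1}$. The canonical greedy numeration system associated with $\beta$ has basis $G_\beta=(G_\ell)_{\ell\in\mathbb{N}}$ with $G_0=1$ and $G_\ell=d_1G_{\ell-1}+d_2G_{\ell-2}+\cdots+d_\ell G_0+1$ for $\ell\ge1$. The greedy expansion of an integer $N\ge1$ in this basis: let $k$ be such that $G_k\le N<G_{k+1}$; let $x_k$ and $\rho_k$ be the quotient and remainder of the Euclidean division of $N$ by $G_k$; for $i=k-1,\ldots,0$ let $x_i$ and $\rho_i$ be the quotient and remainder of the division of $\rho_{i+1}$ by $G_i$; then $\langle N\rangle=x_kx_{k-1}\cdots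 x_0$, and $\langle0\rangle=\varepsilon$. The language is $L_\beta=\{\langle N\rangle: N\in\mathbb{N}\}$. For words $u,v$: if $|u|=|v|$, $\Delta(u,v)$ is $|u|$ minus the length of the longest common prefix of $u$ and $v$; if $|u|\neq|v|$, $\Delta(u,v)=\max(|u|,|v|)$. The carry propagation of $L_\beta$ is the (finite) limit, if it exists, $\mathsf{CP}_\beta=\lim_{N\to\infty}\frac1N\sum_{i=0}^{N-1}\Delta(\langle i\rangle,\langle i+1\rangle)$. *)

theory Defs
  imports Complex_Main "HOL-Library.Sublist"
begin

text \<open>The sequences \<open>(t\<^sub>i)\<close> and \<open>(d\<^sub>i)\<close> below are indexed from 1;
  their values at index 0 are never used.\<close>

primrec beta_remainder :: "real \<Rightarrow> nat \<Rightarrow> real" where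
  "beta_remainder \<beta> 0 = 1"
| "beta_remainder \<beta> (Suc i) = frac (\<beta> * beta_remainder \<beta> i)"

definition beta_digit :: "real \<Rightarrow> nat \<Rightarrow> nat" where
  "beta_digit \<beta> i = nat \<lfloor>\<beta> * beta_remainder \<beta> (i - 1)\<rfloor>"

definition finite_expansion :: "(nat \<Rightarrow> nat) \<Rightarrow> bool" where
  "finite_expansion t \<longleftrightarrow> (\<exists>m. \<forall>n>m. t n = 0)"

text \<open>For the expansion of 1, where \<open>t\<^sub>1 \<noteq> 0\<close>, this is the largest \<open>m\<close> with
  \<open>t\<^sub>m \<noteq> 0\<close>.\<close>

definition expansion_length :: "(nat \<Rightarrow> nat) \<Rightarrow> nat" where
  "expansion_length t = (LEAST m. \<forall>n>m. t n = 0)"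

text \<open>In the finite case, the \<open>m\<close>-periodic sequence
  \<open>(t\<^sub>1 \<dots> t\<^bsub>m-1\<^esub> (t\<^sub>m - 1))\<^sup>\<omega>\<close>.\<close>

definition quasi_greedy_digit :: "real \<Rightarrow> nat \<Rightarrow> nat" where
  "quasi_greedy_digit \<beta> i =
     (let t = beta_digit \<beta> in
      if finite_expansion t then
        (let m = expansion_length t; j = (i - 1) mod m + 1
         in if j = m then t m - 1 else t j)
      else t i)"

fun canonical_basis :: "real \<Rightarrow> nat \<Rightarrow> nat" where
  "canonical_basis \<beta> 0 = 1"
| "canonical_basis \<beta> (Suc l) =
     (\<Sum>i\<le>l. quasi_greedy_digit \<beta> (Suc i) * canonical_basis \<beta> (l - i)) + 1"

text \<open>The successive quotients \<open>x\<^sub>k x\<^bsub>k-1\<^esub> \<dots> x\<^sub>0\<close>, most significant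
  digit first.\<close>

primrec greedy_digits :: "(nat \<Rightarrow> nat) \<Rightarrow> nat \<Rightarrow> nat \<Rightarrow> nat list" where
  "greedy_digits G 0 N = [N div G 0]"
| "greedy_digits G (Suc k) N = (N div G (Suc k)) # greedy_digits G k (N mod G (Suc k))"

definition greedy_expansion :: "(nat \<Rightarrow> nat) \<Rightarrow> nat \<Rightarrow> nat list" where
  "greedy_expansion G N =
     (if N = 0 then [] else greedy_digits G (THE k. G k \<le> N \<and> N < G (Suc k)) N)"

definition word_delta :: "'a list \<Rightarrow> 'a list \<Rightarrow> nat" where
  "word_delta u v =
     (if length u = length v then length u - length (longest_common_prefix u v)
      else max (length u) (length v))"

text \<open>The language \<open>L\<^sub>\<beta>\<close> enters through its enumeration
  \<open>N \<mapsto> \<langle>N\<rangle>\<close>.\<close>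

definition beta_word :: "real \<Rightarrow> nat \<Rightarrow> nat list" where
  "beta_word \<beta> = greedy_expansion (canonical_basis \<beta>)"

definition carry_average :: "(nat \<Rightarrow> 'a list) \<Rightarrow> nat \<Rightarrow> real" where
  "carry_average w N = (1 / real N) * (\<Sum>i<N. real (word_delta (w i) (w (i + 1))))"

definition carry_propagation_exists :: "(nat \<Rightarrow> 'a list) \<Rightarrow> bool" where
  "carry_propagation_exists w \<longleftrightarrow> convergent (carry_average w)"

definition carry_propagation :: "(nat \<Rightarrow> 'a list) \<Rightarrow> real" where
  "carry_propagation w = lim (carry_average w)"

end

theory Submission
  imports Defs "HOL-Analysis.Uniform_Limit"
begin

text \<open>
  Let \<open>S\<^sub>n = G\<^sub>0 + \<dots> + G\<^sub>n\<close>, and for \<open>N\<close> with greedy digits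
  \<open>x\<^sub>k \<dots> x\<^sub>0\<close> let \<open>F(N) = \<Sum>\<^sub>i x\<^sub>i S\<^sub>i\<close>. The proof rests on two facts: the total carry
  \<open>\<Sum>\<^bsub>i<N\<^esub> \<Delta>(\<langle>i\<rangle>, \<langle>i+1\<rangle>)\<close> is exactly \<open>F(N)\<close>, and
  \<open>S\<^sub>n / G\<^sub>n\<close> tends to \<open>\<beta> / (\<beta> - 1)\<close>. As \<open>N = \<Sum>\<^sub>i x\<^sub>i G\<^sub>i\<close>, the two together give
  the limit of \<open>F(N) / N\<close>.

  For the first fact (\<open>sum_word_delta\<close>), passing from \<open>N\<close> to \<open>N + 1\<close> with a carry that
  reaches position \<open>k\<close> replaces the low part \<open>G\<^sub>k - 1\<close> of \<open>N\<close> by \<open>G\<^sub>k\<close>, so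
  \<open>F\<close> grows by \<open>S\<^sub>k - F(G\<^sub>k - 1)\<close>. The greedy digits of \<open>G\<^sub>k - 1\<close> are the first \<open>k\<close>
  quasi-greedy digits \<open>d\<^sub>0, \<dots>, d\<^bsub>k-1\<^esub>\<close> of 1, and the
  recurrence of the basis then makes the difference equal to \<open>k + 1\<close>, the number of digits that change. That these digits are greedy is the Parry condition.
  It comes from the orbit \<open>q\<^sub>0 = 1\<close>, \<open>q\<^bsub>i+1\<^esub> = \<beta> q\<^sub>i - d\<^sub>i\<close>, which stays in the half-open
  interval \<open>(0,1]\<close> (\<open>quasi_greedy_remainders\<close>): there the digit is determined by the point and
  increases with it, and no point exceeds the starting point 1.

  For the second fact (\<open>S_over_G\<close>), put \<open>g\<^sub>n = G\<^sub>n / \<beta>\<^sup>n\<close>. The recurrence of the basis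
  becomes a renewal equation for \<open>g\<close> whose weights are \<open>d\<^sub>i / \<beta>\<^bsup>i+1\<^esup>\<close>, of total mass 1 and
  positive at the first place. Dividing \<open>1 - \<Sum>\<^sub>i d\<^sub>i x\<^bsup>i+1\<^esup>\<close> by \<open>1 - \<beta> x\<close>
  leaves the generating function of \<open>q\<close>, so the convolution of \<open>q\<close> and \<open>G\<close> is explicit
  (\<open>remainder_convolution\<close>); this bounds \<open>g\<close> and fixes the only possible limit. The
  renewal theorem then gives \<open>g\<^sub>n \<longlonglongrightarrow> c > 0\<close>, and
  \<open>S\<^sub>n / \<beta>\<^sup>n = \<Sum>\<^sub>i g\<^bsub>n-i\<^esub> / \<beta>\<^sup>i\<close> tends to \<open>c \<beta> / (\<beta> - 1)\<close>.
\<close>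

section \<open>Convolutions and the renewal theorem\<close>

text \<open>Dominated convergence for series. The limit is taken along indices \<open>s n\<close> because the
  renewal argument controls a sequence only along a subsequence.\<close>

lemma convolution_tendsto_along:
  fixes a x b :: "nat \<Rightarrow> real" and s :: "nat \<Rightarrow> nat"
  assumes a: "\<And>i. a i \<ge> 0" "summable a"
    and M: "\<And>n. \<bar>x n\<bar> \<le> M"
    and s: "filterlim s at_top sequentially"
    and lim: "\<And>i. (\<lambda>n. x (s n - i)) \<longlonglongrightarrow> b i"
  shows "(\<lambda>n. \<Sum>i\<le>s n. a i * x (s n - i)) \<longlonglongrightarrow> (\<Sum>i. a i * b i)"
proof -
  define f where "f i n = (if i \<le> s n then a i * x (s n - i) else 0)" for i n
  have "f i \<longlonglongrightarrow> a i * b i" for i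
  proof (rule Lim_transform_eventually)
    show "(\<lambda>n. a i * x (s n - i)) \<longlonglongrightarrow> a i * b i"
      by (intro tendsto_mult_left lim)
    have "\<forall>\<^sub>F n in sequentially. i \<le> s n"
      using s by (simp add: filterlim_at_top)
    then show "\<forall>\<^sub>F n in sequentially. a i * x (s n - i) = f i n"
      by eventually_elim (simp add: f_def)
  qed
  moreover have "norm (f i n) \<le> a i * M" for i n
    using M[of 0] a(1)[of i] M[of "s n - i"]
    by (auto simp: f_def abs_mult intro!: mult_left_mono mult_nonneg_nonneg)
  moreover have "summable (\<lambda>i. a i * M)"
    by (intro summable_mult2 a)
  ultimately have "(\<lambda>n. \<Sum>i. f i n) \<longlonglongrightarrow> (\<Sum>i. a i * b i)"
    using tannerys_theorem[of f "\<lambda>i. a i * b i" sequentially "\<lambda>i. a i * M"]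
    by (simp add: case_prod_unfold)
  moreover have "(\<Sum>i. f i n) = (\<Sum>i\<le>s n. a i * x (s n - i))" for n
    by (subst suminf_finite[of "{..s n}"]) (auto simp: f_def)
  ultimately show ?thesis by simp
qed

lemma convolution_tendsto:
  fixes a x :: "nat \<Rightarrow> real"
  assumes a: "\<And>i. a i \<ge> 0" "summable a"
    and lim: "x \<longlonglongrightarrow> L"
  shows "(\<lambda>n. \<Sum>i\<le>n. a i * x (n - i)) \<longlonglongrightarrow> suminf a * L"
proof -
  obtain M where M: "\<And>n. \<bar>x n\<bar> \<le> M"
    using convergent_imp_Bseq[OF convergentI[OF lim]] unfolding Bseq_def real_norm_def by blast
  have "(\<lambda>n. x (n - i)) \<longlonglongrightarrow> L" for i
    by (rule LIMSEQ_offset[of _ i]) (simp add: lim)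
  then show ?thesis
    using convolution_tendsto_along[where x = x and s = "\<lambda>n. n" and b = "\<lambda>_. L", OF a M]
      suminf_mult2[OF a(2), of L] by (simp add: filterlim_ident)
qed

text \<open>The envelope is \<open>u\<^sub>n = sup\<^bsub>j\<ge>n\<^esub> g\<^sub>j\<close>, with limit \<open>L\<close> say. The gap
  \<open>v = u - g\<close> is nonnegative, and it is small at suitable indices. By the renewal equation,
  \<open>v\<^bsub>n+1\<^esub>\<close> is a weighted mean of earlier gaps up to a vanishing error; as all gaps are
  nonnegative and \<open>a\<^sub>0 > 0\<close>, a small gap at \<open>n + 1\<close> forces a small gap at \<open>n\<close>, hence at
  \<open>n - i\<close> for every fixed \<open>i\<close>. Along these indices \<open>g\<close> may be replaced by \<open>u\<close> in the
  convolution with \<open>w\<close>, which gives \<open>A = L \<Sum>w\<close>.\<close>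

lemma renewal_upper_envelope:
  fixes a w g e :: "nat \<Rightarrow> real"
  assumes a: "\<And>i. a i \<ge> 0" "a 0 > 0" "a sums 1"
    and w: "\<And>i. w i \<ge> 0" "summable w" "suminf w > 0"
    and bound: "\<And>n. \<bar>g n\<bar> \<le> M"
    and rec: "\<And>n. g (Suc n) = (\<Sum>i\<le>n. a i * g (n - i)) + e n"
    and e: "e \<longlonglongrightarrow> 0"
    and conv: "(\<lambda>n. \<Sum>i\<le>n. w i * g (n - i)) \<longlonglongrightarrow> A"
  obtains u where "\<And>n. g n \<le> u n" "u \<longlonglongrightarrow> A / suminf w"
proof -
  define u where "u n = (SUP j\<in>{n..}. g j)" for n
  define v where "v n = u n - g n" for n
  have bdd: "bdd_above (g ` B)" for B
    using bound by (intro bdd_aboveI[of _ M]) (force simp: abs_le_iff)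
  have g_le_u: "g j \<le> u n" if "n \<le> j" for j n
    unfolding u_def using that by (intro cSUP_upper bdd) auto
  have u_le: "u n \<le> M" for n
    unfolding u_def using bound by (intro cSUP_least) (auto simp: abs_le_iff)
  have u_ge: "-M \<le> u n" for n
    using g_le_u[of n n] bound[of n] by (simp add: abs_le_iff)
  have "decseq u"
    unfolding decseq_def u_def by (intro allI impI cSUP_subset_mono bdd) auto
  then obtain L where L: "u \<longlonglongrightarrow> L"
    using u_ge by (auto elim!: decseq_convergent[of u "-M"])
  have v_nonneg: "v n \<ge> 0" for n
    using g_le_u[of n n] by (simp add: v_def)
  have v_bound: "\<bar>v n\<bar> \<le> 2 * M" for n
    using v_nonneg[of n] u_le[of n] bound[of n] by (simp add: v_def abs_le_iff)
  \<comment> \<open>The error made when the upper envelope is put into the renewal equation.\<close>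
  define h where "h n = (\<Sum>i\<le>n. a i * u (n - i)) - u (Suc n) + e n" for n
  have h_lim: "h \<longlonglongrightarrow> 0"
  proof -
    have "h \<longlonglongrightarrow> suminf a * L - L + 0"
      unfolding h_def using a L e
      by (intro tendsto_intros convolution_tendsto LIMSEQ_Suc) (auto simp: sums_iff)
    then show ?thesis using a by (simp add: sums_iff)
  qed
  have v_step: "a 0 * v n \<le> v (Suc n) + h n" for n
  proof -
    have "a 0 * v n \<le> (\<Sum>i\<le>n. a i * v (n - i))"
      using member_le_sum[of 0 "{..n}" "\<lambda>i. a i * v (n - i)"] a v_nonneg by simp
    also have "\<dots> = v (Suc n) + h n"
      using rec[of n] by (simp add: v_def h_def right_diff_distrib sum_subtractf)
    finally show ?thesis .
  qed
  have "\<exists>j\<ge>n. v j \<le> 1 / real (Suc n)" for n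
  proof -
    have "\<exists>j\<in>{n..}. u n - 1 / real (Suc n) < g j"
      using less_cSUP_iff[of "{n..}" g "u n - 1 / real (Suc n)"] bdd
      by (simp add: u_def[of n])
    then obtain j where "j \<ge> n" "u n - 1 / real (Suc n) < g j" by auto
    moreover have "u j \<le> u n"
      using \<open>decseq u\<close> \<open>j \<ge> n\<close> by (simp add: decseq_def)
    ultimately show ?thesis by (intro exI[of _ j]) (simp add: v_def)
  qed
  then obtain s where s: "\<And>n. s n \<ge> n" "\<And>n. v (s n) \<le> 1 / real (Suc n)" by metis
  have s_top: "filterlim s at_top sequentially"
    using s(1) filterlim_at_top_mono[OF filterlim_ident, of s] by (simp add: eventually_sequentially)
  have v_lim: "(\<lambda>n. v (s n - i)) \<longlonglongrightarrow> 0" for i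
  proof (induction i)
    case 0
    have "(\<lambda>n. 1 / real (Suc n)) \<longlonglongrightarrow> 0"
      using LIMSEQ_Suc[OF lim_1_over_n] .
    then show ?case
      by (rule tendsto_sandwich[rotated 3]) (use v_nonneg s in auto)
  next
    case (Suc i)
    have "filterlim (\<lambda>n. s n - Suc i) at_top sequentially"
      using filterlim_compose[OF filterlim_minus_const_nat_at_top s_top] .
    then have "(\<lambda>n. h (s n - Suc i)) \<longlonglongrightarrow> 0"
      by (rule filterlim_compose[OF h_lim])
    then have "(\<lambda>n. (v (s n - i) + h (s n - Suc i)) / a 0) \<longlonglongrightarrow> (0 + 0) / a 0"
      using a(2) by (intro tendsto_intros Suc) auto
    then have lim: "(\<lambda>n. (v (s n - i) + h (s n - Suc i)) / a 0) \<longlonglongrightarrow> 0" by simp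
    have "\<forall>\<^sub>F n in sequentially. v (s n - Suc i) \<le> (v (s n - i) + h (s n - Suc i)) / a 0"
      using eventually_gt_at_top[of i]
    proof eventually_elim
      case (elim n)
      then have "Suc (s n - Suc i) = s n - i" using s(1)[of n] by simp
      then show ?case
        using v_step[of "s n - Suc i"] a(2) by (simp add: field_simps)
    qed
    moreover have "\<forall>\<^sub>F n in sequentially. 0 \<le> v (s n - Suc i)"
      using v_nonneg by simp
    ultimately show ?case
      using tendsto_sandwich[of "\<lambda>_. 0", OF _ _ tendsto_const lim] by simp
  qed
  have "(\<lambda>n. (\<Sum>i\<le>s n. w i * u (s n - i)) - (\<Sum>i\<le>s n. w i * v (s n - i)))
      \<longlonglongrightarrow> suminf w * L - (\<Sum>i. w i * 0)"
    by (intro tendsto_diff convolution_tendsto_along[OF w(1,2) v_bound s_top v_lim]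
          filterlim_compose[OF convolution_tendsto[OF w(1,2) L] s_top])
  moreover have "(\<Sum>i\<le>n. w i * u (n - i)) - (\<Sum>i\<le>n. w i * v (n - i))
      = (\<Sum>i\<le>n. w i * g (n - i))" for n
    by (simp add: v_def right_diff_distrib sum_subtractf)
  ultimately have "(\<lambda>n. \<Sum>i\<le>s n. w i * g (s n - i)) \<longlonglongrightarrow> suminf w * L" by simp
  then have "A = suminf w * L"
    using filterlim_compose[OF conv s_top] LIMSEQ_unique by blast
  then have "L = A / suminf w" using w(3) by simp
  with L g_le_u that show thesis by blast
qed

text \<open>The hypotheses are linear in \<open>(g, e, A)\<close>, so the negated envelope of \<open>-g\<close> bounds
  \<open>g\<close> from below with the same limit.\<close>

lemma renewal_theorem:
  fixes a w g e :: "nat \<Rightarrow> real"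
  assumes a: "\<And>i. a i \<ge> 0" "a 0 > 0" "a sums 1"
    and w: "\<And>i. w i \<ge> 0" "summable w" "suminf w > 0"
    and bound: "\<And>n. \<bar>g n\<bar> \<le> M"
    and rec: "\<And>n. g (Suc n) = (\<Sum>i\<le>n. a i * g (n - i)) + e n"
    and e: "e \<longlonglongrightarrow> 0"
    and conv: "(\<lambda>n. \<Sum>i\<le>n. w i * g (n - i)) \<longlonglongrightarrow> A"
  shows "g \<longlonglongrightarrow> A / suminf w"
proof -
  obtain u where u: "\<And>n. g n \<le> u n" "u \<longlonglongrightarrow> A / suminf w"
    using renewal_upper_envelope[OF a w bound rec e conv] by blast
  have "(\<lambda>n. - e n) \<longlonglongrightarrow> 0" "(\<lambda>n. \<Sum>i\<le>n. w i * - g (n - i)) \<longlonglongrightarrow> - A"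
    using tendsto_minus[OF e] tendsto_minus[OF conv] by (simp_all add: sum_negf)
  moreover have "\<bar>- g n\<bar> \<le> M" "- g (Suc n) = (\<Sum>i\<le>n. a i * - g (n - i)) + - e n" for n
    using bound[of n] rec[of n] by (simp_all add: sum_negf)
  ultimately obtain l where l: "\<And>n. - g n \<le> l n" "l \<longlonglongrightarrow> - A / suminf w"
    using renewal_upper_envelope[OF a w, of "\<lambda>n. - g n" M "\<lambda>n. - e n" "- A"] by blast
  have "(\<lambda>n. - l n) \<longlonglongrightarrow> A / suminf w"
    using tendsto_minus[OF l(2)] by simp
  then show ?thesis
    by (rule tendsto_sandwich[rotated 2]) (use u l(1) in \<open>auto simp: minus_le_iff\<close>)
qed

section \<open>Weighted digit sums and word distances\<close>

definition window :: "(nat \<Rightarrow> nat) \<Rightarrow> (nat \<Rightarrow> nat) \<Rightarrow> nat \<Rightarrow> nat \<Rightarrow> nat" where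
  "window d X a n = (\<Sum>i<n. d (a + i) * X (n - Suc i))"

lemma window_0 [simp]: "window d X a 0 = 0"
  by (simp add: window_def)

lemma window_Suc: "window d X a (Suc n) = d a * X n + window d X (Suc a) n"
  unfolding window_def by (subst sum.lessThan_Suc_shift) simp

text \<open>The digits are always the greedy ones for \<open>G\<close>, but they are weighted by \<open>X\<close>:
  for \<open>X = G\<close> with \<open>G 0 = 1\<close> the value is \<open>N\<close>, and when \<open>X\<close> is the sequence of partial sums
  of a quasi-greedy basis \<open>G\<close> it is the total carry below \<open>N\<close>.\<close>

primrec greedy_weight :: "(nat \<Rightarrow> nat) \<Rightarrow> (nat \<Rightarrow> nat) \<Rightarrow> nat \<Rightarrow> nat \<Rightarrow> nat" where
  "greedy_weight G X 0 N = N div G 0 * X 0"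
| "greedy_weight G X (Suc k) N
     = N div G (Suc k) * X (Suc k) + greedy_weight G X k (N mod G (Suc k))"

lemma length_greedy_digits [simp]: "length (greedy_digits G k N) = Suc k"
  by (induction k arbitrary: N) auto

lemma word_delta_Cons_same:
  "length u = length v \<Longrightarrow> word_delta (x # u) (x # v) = word_delta u v"
  by (simp add: word_delta_def)

lemma word_delta_Cons_diff:
  "x \<noteq> y \<Longrightarrow> length u = length v \<Longrightarrow> word_delta (x # u) (y # v) = Suc (length u)"
  by (simp add: word_delta_def)

section \<open>The numeration system of a quasi-greedy digit sequence\<close>

text \<open>Digits are indexed from 0 here, so \<open>d 0\<close> is the leading digit of the expansion of 1.
  The half-open range \<open>(0,1]\<close> of the remainders, instead of \<open>[0,1)\<close>, is what distinguishes the
  quasi-greedy expansion from the greedy one, and it covers finite and infinite expansions alike.\<close>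

locale quasi_greedy_basis =
  fixes \<beta> :: real and d :: "nat \<Rightarrow> nat" and q :: "nat \<Rightarrow> real" and G :: "nat \<Rightarrow> nat"
  assumes \<beta>_gt_1: "\<beta> > 1"
    and q_0: "q 0 = 1"
    and q_pos: "q i > 0"
    and q_le_1: "q i \<le> 1"
    and q_Suc: "q (Suc i) = \<beta> * q i - real (d i)"
    and G_0: "G 0 = 1"
    and G_Suc: "G (Suc n) = (\<Sum>i\<le>n. d i * G (n - i)) + 1"
begin

lemma d_0_pos: "d 0 > 0"
proof (rule ccontr)
  assume "\<not> 0 < d 0"
  then show False using q_Suc[of 0] q_0 q_le_1[of 1] \<beta>_gt_1 by simp
qed

lemma G_window: "G n = window d G 0 n + 1"
  by (cases n) (simp_all add: G_0 G_Suc window_def lessThan_Suc_atMost)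

lemma G_pos: "G n > 0"
  by (simp add: G_window)

lemma G_less_Suc: "G n < G (Suc n)"
proof -
  have "G n \<le> d 0 * G (n - 0)" using d_0_pos by simp
  also have "\<dots> \<le> (\<Sum>i\<le>n. d i * G (n - i))"
    by (intro member_le_sum) auto
  finally show ?thesis by (simp add: G_Suc)
qed

lemma G_strict_mono: "strict_mono G"
  using G_less_Suc by (simp add: strict_mono_Suc_iff)

lemma G_gt: "n < G n"
proof (induction n)
  case (Suc n)
  then show ?case using G_less_Suc[of n] by linarith
qed (simp add: G_0)

text \<open>This is the Parry condition in numerical form. If \<open>q a \<le> q b\<close> then \<open>d a \<le> d b\<close>, as
  both next remainders lie in \<open>(0,1]\<close>. Equal digits preserve the order of the remainders; a smaller
  digit loses a full \<open>G n\<close>, which the rest of the block cannot make up, since it is at most the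
  initial block of length \<open>n\<close>, of value \<open>G n - 1\<close>.\<close>

lemma window_mono: "q a \<le> q b \<Longrightarrow> window d G a n \<le> window d G b n"
proof (induction n arbitrary: a b)
  case (Suc n)
  have "\<beta> * q a \<le> \<beta> * q b" using Suc.prems \<beta>_gt_1 by simp
  then have "real (d a) < real (d b) + 1"
    using q_Suc[of a] q_Suc[of b] q_pos[of "Suc a"] q_le_1[of "Suc b"] by linarith
  then consider "d a = d b" | "d a < d b" by linarith
  then show ?case
  proof cases
    case 1
    then have "q (Suc a) \<le> q (Suc b)"
      using \<open>\<beta> * q a \<le> \<beta> * q b\<close> q_Suc[of a] q_Suc[of b] by simp
    then show ?thesis using Suc.IH 1 by (simp add: window_Suc)
  next
    case 2
    have "window d G (Suc a) n \<le> window d G 0 n"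
      using Suc.IH q_le_1 q_0 by metis
    also have "\<dots> < G n" by (simp add: G_window)
    finally have "window d G a (Suc n) \<le> Suc (d a) * G n" by (simp add: window_Suc)
    also have "\<dots> \<le> d b * G n" using 2 by (intro mult_le_mono1) simp
    finally show ?thesis by (simp add: window_Suc)
  qed
qed simp

lemma window_less: "window d G a n < G n"
  using window_mono[of a 0 n] q_0 q_le_1[of a] by (simp add: G_window)

definition S :: "nat \<Rightarrow> nat" where "S n = (\<Sum>j\<le>n. G j)"

lemma S_0: "S 0 = 1" and S_Suc: "S (Suc n) = S n + G (Suc n)"
  by (simp_all add: S_def G_0)

text \<open>Blocks of \<open>d\<close> are greedy expansions, because each tail of a block is smaller than the
  basis element above it.\<close>

lemma greedy_weight_window: "greedy_weight G X k (window d G a (Suc k)) = window d X a (Suc k)"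
proof (induction k arbitrary: a)
  case 0
  then show ?case by (simp add: window_Suc G_0)
next
  case (Suc k)
  have "window d G a (Suc (Suc k)) = window d G (Suc a) (Suc k) + d a * G (Suc k)"
    using window_Suc[of d G a "Suc k"] by simp
  then have "window d G a (Suc (Suc k)) div G (Suc k) = d a"
    "window d G a (Suc (Suc k)) mod G (Suc k) = window d G (Suc a) (Suc k)"
    using window_less[of "Suc a" "Suc k"] by simp_all
  then show ?case
    using Suc.IH[of "Suc a"] window_Suc[of d X a "Suc k"] by simp
qed

text \<open>Sum the recurrence of the basis over all indices up to \<open>n\<close>.\<close>

lemma S_window: "S n = window d S 0 n + Suc n"
proof (induction n)
  case 0
  then show ?case by (simp add: S_0)
next
  case (Suc n)
  have "window d S 0 (Suc n) = window d S 0 n + window d G 0 (Suc n)"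
  proof -
    have "d i * S (n - i) = d i * S (n - Suc i) + d i * G (n - i)" if "i < n" for i
    proof -
      have "n - i = Suc (n - Suc i)" using that by simp
      then show ?thesis by (simp add: S_Suc algebra_simps)
    qed
    then have "(\<Sum>i<n. d i * S (n - i)) = (\<Sum>i<n. d i * S (n - Suc i)) + (\<Sum>i<n. d i * G (n - i))"
      by (simp add: sum.distrib)
    \<comment> \<open>The last digit contributes \<open>S 0 = G 0\<close>, which goes to the second block.\<close>
    then show ?thesis by (simp add: window_def S_0 G_0)
  qed
  then show ?case using Suc G_window[of "Suc n"] by (simp add: S_Suc)
qed

text \<open>The largest number with \<open>k + 1\<close> digits has the first \<open>k + 1\<close> elements of \<open>d\<close> as
  its greedy digits.\<close>

lemma greedy_weight_pred_G:
  "S (Suc k) = greedy_weight G S k (G (Suc k) - 1) + Suc (Suc k)"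
  using S_window[of "Suc k"] greedy_weight_window[of S k 0] G_window[of "Suc k"] by simp

section \<open>The total carry as a weighted digit sum\<close>

text \<open>Either the low part can be incremented without touching the leading digit, or it is
  \<open>G (Suc k) - 1\<close>; then it is reset to 0, all \<open>k + 2\<close> digits count as changed, and the weight
  grows by the same amount by \<open>greedy_weight_pred_G\<close>.\<close>

lemma greedy_weight_Suc:
  "greedy_weight G S k (Suc N)
     = greedy_weight G S k N + word_delta (greedy_digits G k N) (greedy_digits G k (Suc N))"
proof (induction k arbitrary: N)
  case 0
  then show ?case by (simp add: G_0 S_0 word_delta_Cons_diff)
next
  case (Suc k)
  let ?G = "G (Suc k)"
  show ?case
  proof (cases "Suc (N mod ?G) = ?G")
    case True
    then have "Suc N div ?G = Suc (N div ?G)" "Suc N mod ?G = 0" "N mod ?G = ?G - 1"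
      by (auto simp: div_Suc mod_Suc)
    moreover have "greedy_weight G S k 0 = 0" for k
      by (induction k) auto
    ultimately show ?thesis
      using greedy_weight_pred_G[of k] by (simp add: word_delta_Cons_diff)
  next
    case False
    then have "Suc N div ?G = N div ?G" "Suc N mod ?G = Suc (N mod ?G)"
      by (auto simp: div_Suc mod_Suc)
    then show ?thesis using Suc.IH[of "N mod ?G"] by (simp add: word_delta_Cons_same)
  qed
qed

lemma greedy_weight_stable:
  assumes "N < G (Suc k)" "k \<le> j"
  shows "greedy_weight G X j N = greedy_weight G X k N"
  using assms(2)
proof (induction j rule: dec_induct)
  case (step j)
  have "G (Suc k) \<le> G (Suc j)"
    using step.hyps G_strict_mono by (simp add: strict_mono_less_eq)
  then show ?case using step.IH assms(1) by simp
qed simp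

lemma leading_position:
  assumes "N > 0"
  obtains k where "G k \<le> N" "N < G (Suc k)" "(THE k. G k \<le> N \<and> N < G (Suc k)) = k"
proof -
  define k where "k = (LEAST k. N < G (Suc k))"
  have "N < G (Suc N)" using G_gt[of "Suc N"] by simp
  then have k: "N < G (Suc k)" unfolding k_def by (rule LeastI)
  have "G k \<le> N"
  proof (cases k)
    case 0
    then show ?thesis using assms G_0 by simp
  next
    case (Suc j)
    then show ?thesis using not_less_Least[of j "\<lambda>k. N < G (Suc k)"] k_def by simp
  qed
  moreover have "i = k" if i: "G i \<le> N" "N < G (Suc i)" for i
  proof -
    have "G i < G (Suc k)" "G k < G (Suc i)" using i k \<open>G k \<le> N\<close> by linarith+
    then show ?thesis using G_strict_mono by (simp add: strict_mono_less)
  qed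
  ultimately show thesis using that k by (metis (mono_tags, lifting) the_equality)
qed

text \<open>Padding with leading zeros does not alter the distance of consecutive words. When
  \<open>N + 1\<close> has one digit more than \<open>N\<close>, the distance of words of different length and the
  distance of the padded words are both the length of the longer word.\<close>

lemma word_delta_greedy_expansion:
  assumes "N + 1 < G (Suc j)"
  shows "word_delta (greedy_expansion G N) (greedy_expansion G (N + 1))
    = word_delta (greedy_digits G j N) (greedy_digits G j (N + 1))"
proof -
  obtain k where k: "G k \<le> N + 1" "N + 1 < G (Suc k)"
    "(THE k. G k \<le> N + 1 \<and> N + 1 < G (Suc k)) = k"
    using leading_position[of "N + 1"] by auto
  have "G k < G (Suc j)" using k(1) assms by simp
  then have "k \<le> j" using G_strict_mono by (simp add: strict_mono_less)
  \<comment> \<open>The weight does not see leading zeros, hence neither do its increments.\<close>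
  have padded: "word_delta (greedy_digits G j N) (greedy_digits G j (N + 1))
      = word_delta (greedy_digits G k N) (greedy_digits G k (N + 1))"
    using greedy_weight_Suc[of j N] greedy_weight_Suc[of k N]
      greedy_weight_stable[of N k j S] greedy_weight_stable[of "N + 1" k j S] k(2) \<open>k \<le> j\<close>
    by simp
  have new: "greedy_expansion G (N + 1) = greedy_digits G k (N + 1)"
    using k(3) by (simp add: greedy_expansion_def)
  show ?thesis
  proof (cases "G k \<le> N")
    case True
    then have "N > 0" using G_pos[of k] by linarith
    then obtain i where i: "G i \<le> N" "N < G (Suc i)" "(THE k. G k \<le> N \<and> N < G (Suc k)) = i"
      using leading_position by blast
    have "G i < G (Suc k)" "G k < G (Suc i)" using i k True by linarith+
    then have "i = k" using G_strict_mono by (simp add: strict_mono_less)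
    then have "greedy_expansion G N = greedy_digits G k N"
      using i(3) \<open>N > 0\<close> by (simp add: greedy_expansion_def)
    then show ?thesis using new padded by simp
  next
    case False
    then have Gk: "G k = Suc N" using k(1) by simp
    have "length (greedy_expansion G N) < Suc k"
    proof (cases "N = 0")
      case False
      then obtain i where i: "G i \<le> N" "(THE k. G k \<le> N \<and> N < G (Suc k)) = i"
        using leading_position[of N] by auto
      have "G i < G k" using i Gk by simp
      then have "i < k" using G_strict_mono by (simp add: strict_mono_less)
      then show ?thesis using i False by (simp add: greedy_expansion_def)
    qed (simp add: greedy_expansion_def)
    then have "word_delta (greedy_expansion G N) (greedy_expansion G (N + 1)) = Suc k"
      using new by (simp add: word_delta_def)
    moreover have "word_delta (greedy_digits G k N) (greedy_digits G k (N + 1)) = Suc k"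
    proof (cases k)
      case 0
      then show ?thesis by (simp add: G_0 word_delta_Cons_diff)
    next
      case (Suc i)
      then show ?thesis using Gk by (simp add: word_delta_Cons_diff)
    qed
    ultimately show ?thesis using padded by simp
  qed
qed

lemma sum_word_delta:
  assumes "N < G (Suc j)"
  shows "(\<Sum>i<N. word_delta (greedy_expansion G i) (greedy_expansion G (i + 1)))
    = greedy_weight G S j N"
  using assms
proof (induction N)
  case 0
  have "greedy_weight G S k 0 = 0" for k
    by (induction k) auto
  then show ?case by simp
next
  case (Suc N)
  then show ?case
    using word_delta_greedy_expansion[of N j] greedy_weight_Suc[of j N] by simp
qed

section \<open>Asymptotics of the basis\<close>

text \<open>For the generating functions \<open>D\<close>, \<open>Q\<close>, \<open>G\<close> of \<open>d\<close>, \<open>q\<close> and the basis,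
  \<open>1 - x D(x) = (1 - \<beta> x) Q(x)\<close> and \<open>(1 - x D(x)) G(x) = 1 / (1 - x)\<close>, so that \<open>Q(x) G(x) = 1 / ((1 - x) (1 - \<beta> x))\<close>.\<close>

lemma remainder_convolution:
  "(\<Sum>i\<le>n. q i * real (G (n - i))) = (\<beta> ^ Suc n - 1) / (\<beta> - 1)"
proof (induction n)
  case 0
  then show ?case using \<beta>_gt_1 by (simp add: q_0 G_0)
next
  case (Suc n)
  have "(\<Sum>i\<le>Suc n. q i * real (G (Suc n - i)))
      = real (G (Suc n)) + (\<Sum>i\<le>n. q (Suc i) * real (G (n - i)))"
    by (subst sum.atMost_Suc_shift) (simp add: q_0)
  also have "\<dots> = 1 + \<beta> * (\<Sum>i\<le>n. q i * real (G (n - i)))"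
    by (simp add: q_Suc G_Suc left_diff_distrib sum_subtractf sum_distrib_left mult.assoc)
  also have "\<dots> = (\<beta> ^ Suc (Suc n) - 1) / (\<beta> - 1)"
    using \<beta>_gt_1 Suc by (simp add: field_simps)
  finally show ?case .
qed

text \<open>By telescoping. As the remainders are bounded, the weights \<open>d\<^sub>i / \<beta>\<^bsup>i+1\<^esup>\<close> of the
  renewal equation have total mass 1.\<close>

lemma sum_digits: "(\<Sum>i<n. real (d i) / \<beta> ^ Suc i) = 1 - q n / \<beta> ^ n"
proof (induction n)
  case (Suc n)
  have "q n / \<beta> ^ n = \<beta> * q n / \<beta> ^ Suc n" using \<beta>_gt_1 by simp
  with Suc show ?case by (simp add: q_Suc diff_divide_distrib del: power_Suc)
qed (simp add: q_0)

lemma inverse_power_lim: "(\<lambda>n. 1 / \<beta> ^ n) \<longlonglongrightarrow> 0"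
  using LIMSEQ_inverse_realpow_zero[OF \<beta>_gt_1] by (simp add: inverse_eq_divide)

lemma inverse_power_sums: "(\<lambda>n. 1 / \<beta> ^ n) sums (\<beta> / (\<beta> - 1))"
  using geometric_sums[of "1 / \<beta>"] \<beta>_gt_1 by (simp add: power_divide field_simps)

lemma G_asymp: "\<exists>c>0. (\<lambda>n. real (G n) / \<beta> ^ n) \<longlonglongrightarrow> c"
proof -
  define g where "g n = real (G n) / \<beta> ^ n" for n
  define a where "a i = real (d i) / \<beta> ^ Suc i" for i
  define w where "w i = q i / \<beta> ^ i" for i
  have \<beta>: "\<beta> > 0" "\<beta> \<noteq> 0" "\<beta> \<ge> 0" using \<beta>_gt_1 by auto
  have pow: "\<beta> ^ n = \<beta> ^ i * \<beta> ^ (n - i)" if "i \<le> n" for i n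
    using that by (simp flip: power_add)
  have w_nonneg: "w i \<ge> 0" for i
    using q_pos[of i] \<beta> by (simp add: w_def)
  have w_le: "w i \<le> 1 / \<beta> ^ i" for i
    using q_le_1[of i] \<beta> by (simp add: w_def divide_right_mono)
  have w_lim: "w \<longlonglongrightarrow> 0"
    by (rule tendsto_sandwich[OF _ _ tendsto_const inverse_power_lim]) (use w_nonneg w_le in auto)
  have w_summable: "summable w"
    using sums_summable[OF inverse_power_sums]
    by (rule summable_comparison_test') (use w_nonneg w_le in auto)
  have w_sum: "suminf w > 0"
    using w_summable w_nonneg q_0 by (intro suminf_pos2[of w 0]) (auto simp: w_def)
  have a_sums: "a sums 1"
  proof -
    have "(\<lambda>n. 1 - w n) \<longlonglongrightarrow> 1 - 0"
      by (intro tendsto_intros w_lim)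
    then show ?thesis
      unfolding sums_def a_def using sum_digits by (simp add: w_def)
  qed
  have conv: "(\<Sum>i\<le>n. w i * g (n - i)) = (\<beta> - 1 / \<beta> ^ n) / (\<beta> - 1)" for n
  proof -
    have "(\<Sum>i\<le>n. w i * g (n - i)) = (\<Sum>i\<le>n. q i * real (G (n - i))) / \<beta> ^ n"
      unfolding sum_divide_distrib by (intro sum.cong) (auto simp: w_def g_def pow)
    also have "\<dots> = (\<beta> - 1 / \<beta> ^ n) / (\<beta> - 1)"
      using \<beta> by (simp add: remainder_convolution diff_divide_distrib)
    finally show ?thesis .
  qed
  have conv_lim: "(\<lambda>n. \<Sum>i\<le>n. w i * g (n - i)) \<longlonglongrightarrow> (\<beta> - 0) / (\<beta> - 1)"
    unfolding conv using \<beta>_gt_1 by (intro tendsto_intros inverse_power_lim) auto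
  have g_nonneg: "g n \<ge> 0" for n
    using \<beta> by (simp add: g_def)
  have "\<bar>g n\<bar> \<le> \<beta> / (\<beta> - 1)" for n
  proof -
    have "w 0 * g (n - 0) \<le> (\<Sum>i\<le>n. w i * g (n - i))"
      using w_nonneg g_nonneg by (intro member_le_sum) auto
    also have "\<dots> \<le> \<beta> / (\<beta> - 1)"
      unfolding conv using \<beta>_gt_1 by (intro divide_right_mono) auto
    finally show ?thesis using g_nonneg by (simp add: w_def q_0)
  qed
  moreover have "g (Suc n) = (\<Sum>i\<le>n. a i * g (n - i)) + 1 / \<beta> ^ Suc n" for n
  proof -
    have "(\<Sum>i\<le>n. a i * g (n - i)) = (\<Sum>i\<le>n. real (d i * G (n - i))) / \<beta> ^ Suc n"
      unfolding sum_divide_distrib by (intro sum.cong) (auto simp: a_def g_def pow)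
    then show ?thesis
      by (simp add: g_def G_Suc add_divide_distrib)
  qed
  moreover have "(\<lambda>n. 1 / \<beta> ^ Suc n) \<longlonglongrightarrow> 0"
    using LIMSEQ_Suc[OF inverse_power_lim] .
  moreover have "a i \<ge> 0" "a 0 > 0" for i
    using \<beta> d_0_pos by (auto simp: a_def)
  ultimately have "g \<longlonglongrightarrow> (\<beta> - 0) / (\<beta> - 1) / suminf w"
    using renewal_theorem[of a w g "\<beta> / (\<beta> - 1)" "\<lambda>n. 1 / \<beta> ^ Suc n" "(\<beta> - 0) / (\<beta> - 1)"]
      a_sums w_nonneg w_summable w_sum conv_lim by blast
  moreover have "(\<beta> - 0) / (\<beta> - 1) / suminf w > 0"
    using \<beta>_gt_1 w_sum by simp
  ultimately show ?thesis unfolding g_def by blast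
qed

lemma S_over_G: "(\<lambda>n. real (S n) / real (G n)) \<longlonglongrightarrow> \<beta> / (\<beta> - 1)"
proof -
  obtain c where c: "c > 0" "(\<lambda>n. real (G n) / \<beta> ^ n) \<longlonglongrightarrow> c"
    using G_asymp by blast
  have \<beta>: "\<beta> > 0" using \<beta>_gt_1 by simp
  have pow: "\<beta> ^ n = \<beta> ^ i * \<beta> ^ (n - i)" if "i \<le> n" for i n
    using that by (simp flip: power_add)
  have "(\<Sum>i\<le>n. 1 / \<beta> ^ i * (real (G (n - i)) / \<beta> ^ (n - i))) = real (S n) / \<beta> ^ n" for n
  proof -
    have "real (S n) = (\<Sum>i\<le>n. real (G (n - i)))"
      unfolding S_def of_nat_sum
      by (rule sum.reindex_bij_witness[of _ "\<lambda>i. n - i" "\<lambda>i. n - i"]) auto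
    then show ?thesis
      by (auto simp: sum_divide_distrib pow intro!: sum.cong)
  qed
  moreover have "(\<lambda>n. \<Sum>i\<le>n. 1 / \<beta> ^ i * (real (G (n - i)) / \<beta> ^ (n - i)))
      \<longlonglongrightarrow> suminf (\<lambda>n. 1 / \<beta> ^ n) * c"
    using inverse_power_sums \<beta> c by (intro convolution_tendsto) (auto simp: sums_iff)
  ultimately have "(\<lambda>n. real (S n) / \<beta> ^ n) \<longlonglongrightarrow> \<beta> / (\<beta> - 1) * c"
    using inverse_power_sums by (simp add: sums_iff)
  then have "(\<lambda>n. (real (S n) / \<beta> ^ n) / (real (G n) / \<beta> ^ n)) \<longlonglongrightarrow> \<beta> / (\<beta> - 1) * c / c"
    using c by (intro tendsto_divide) auto
  then show ?thesis using c \<beta> by simp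
qed

text \<open>Digits at positions \<open>i > m\<close> contribute an error of at most
  \<open>x\<^sub>i \<epsilon> G\<^sub>i\<close>, in total at most \<open>\<epsilon> N\<close>; what remains, at positions up to \<open>m\<close>, is one of
  finitely many numbers, whose errors are all bounded by \<open>K\<close>.\<close>

lemma greedy_weight_asymp:
  assumes "\<epsilon> > 0"
  shows "\<exists>K m. \<forall>k\<ge>m. \<forall>N<G (Suc k).
    \<bar>real (greedy_weight G S k N) - \<beta> / (\<beta> - 1) * real N\<bar> \<le> \<epsilon> * real N + K"
proof -
  define c where "c = \<beta> / (\<beta> - 1)"
  obtain m where m: "\<And>n. n \<ge> m \<Longrightarrow> \<bar>real (S n) / real (G n) - c\<bar> < \<epsilon>"
    using S_over_G assms by (auto simp: lim_sequentially dist_real_def c_def)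
  have SG: "\<bar>real (S n) - c * real (G n)\<bar> \<le> \<epsilon> * real (G n)" if "n \<ge> m" for n
  proof -
    have "real (S n) - c * real (G n) = (real (S n) / real (G n) - c) * real (G n)"
      using G_pos[of n] by (simp add: field_simps)
    then show ?thesis using m[OF that] by (simp add: abs_mult mult_right_mono)
  qed
  define K where "K = (\<Sum>N<G (Suc m). \<bar>real (greedy_weight G S m N) - c * real N\<bar>)"
  have "\<bar>real (greedy_weight G S k N) - c * real N\<bar> \<le> \<epsilon> * real N + K"
    if "k \<ge> m" "N < G (Suc k)" for k N
    using that
  proof (induction k arbitrary: N rule: dec_induct)
    case base
    then have "\<bar>real (greedy_weight G S m N) - c * real N\<bar> \<le> K"
      unfolding K_def by (intro member_le_sum[where f = "\<lambda>N. \<bar>real (greedy_weight G S m N) - c * real N\<bar>"]) auto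
    then show ?case using assms by (simp add: add_increasing)
  next
    case (step k)
    define x r where "x = N div G (Suc k)" and "r = N mod G (Suc k)"
    have N: "real N = real x * real (G (Suc k)) + real r"
      unfolding x_def r_def by (metis div_mult_mod_eq of_nat_add of_nat_mult)
    have "real (greedy_weight G S (Suc k) N) - c * real N
        = real x * (real (S (Suc k)) - c * real (G (Suc k)))
          + (real (greedy_weight G S k r) - c * real r)"
      unfolding N by (simp add: x_def r_def algebra_simps)
    also have "\<bar>\<dots>\<bar> \<le> real x * \<bar>real (S (Suc k)) - c * real (G (Suc k))\<bar>
          + \<bar>real (greedy_weight G S k r) - c * real r\<bar>"
      by (rule order_trans[OF abs_triangle_ineq]) (simp add: abs_mult)
    also have "\<dots> \<le> real x * (\<epsilon> * real (G (Suc k))) + (\<epsilon> * real r + K)"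
      using step.hyps SG[of "Suc k"] step.IH[of r] G_pos[of "Suc k"]
      by (intro add_mono mult_left_mono) (auto simp: r_def)
    also have "\<dots> = \<epsilon> * real N + K" by (simp add: N algebra_simps)
    finally show ?case .
  qed
  then show ?thesis
    unfolding c_def by (intro exI[of _ K] exI[of _ m] allI impI)
qed

lemma carry_average_limit: "carry_average (greedy_expansion G) \<longlonglongrightarrow> \<beta> / (\<beta> - 1)"
proof (rule LIMSEQ_I)
  fix \<epsilon> :: real assume "\<epsilon> > 0"
  define c where "c = \<beta> / (\<beta> - 1)"
  obtain K m where Km: "\<forall>k\<ge>m. \<forall>N<G (Suc k).
    \<bar>real (greedy_weight G S k N) - c * real N\<bar> \<le> \<epsilon> / 2 * real N + K"
    using greedy_weight_asymp[OF half_gt_zero[OF \<open>\<epsilon> > 0\<close>]] unfolding c_def by (elim exE)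
  obtain n0 where n0: "2 * K / \<epsilon> < real n0" using reals_Archimedean2 by blast
  show "\<exists>n0. \<forall>N\<ge>n0. norm (carry_average (greedy_expansion G) N - \<beta> / (\<beta> - 1)) < \<epsilon>"
  proof (intro exI allI impI)
    fix N assume N: "N \<ge> Suc n0"
    define k where "k = max m N"
    have "k < G k" "G k < G (Suc k)" by (rule G_gt G_less_Suc)+
    then have k: "N < G (Suc k)" "k \<ge> m" by (auto simp: k_def)
    have "2 * K / \<epsilon> < real N" using n0 N by linarith
    then have K: "K < \<epsilon> / 2 * real N" using \<open>\<epsilon> > 0\<close> by (simp add: field_simps)
    have "carry_average (greedy_expansion G) N = real (greedy_weight G S k N) / real N"
      unfolding carry_average_def sum_word_delta[OF k(1), symmetric] by simp
    then have "carry_average (greedy_expansion G) N - c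
        = (real (greedy_weight G S k N) - c * real N) / real N"
      using N by (simp add: field_simps)
    also have "\<bar>\<dots>\<bar> \<le> (\<epsilon> / 2 * real N + K) / real N"
      using Km k by (simp add: divide_right_mono)
    also have "\<dots> < \<epsilon>" using K N by (simp add: field_simps)
    finally show "norm (carry_average (greedy_expansion G) N - \<beta> / (\<beta> - 1)) < \<epsilon>"
      by (simp add: c_def)
  qed
qed

end

section \<open>Quasi-greedy remainders of 1\<close>

lemma beta_remainder_bounds:
  "0 \<le> beta_remainder \<beta> i" "beta_remainder \<beta> i \<le> 1"
proof -
  show "0 \<le> beta_remainder \<beta> i" by (cases i) auto
  show "beta_remainder \<beta> i \<le> 1" by (cases i) (auto simp: frac_lt_1 less_imp_le)
qed

lemma beta_remainder_Suc:
  assumes "\<beta> > 1"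
  shows "beta_remainder \<beta> (Suc i) = \<beta> * beta_remainder \<beta> i - real (beta_digit \<beta> (Suc i))"
proof -
  have "0 \<le> \<lfloor>\<beta> * beta_remainder \<beta> i\<rfloor>"
    using assms beta_remainder_bounds(1)[of \<beta> i] by simp
  then show ?thesis by (simp add: beta_digit_def frac_def)
qed

text \<open>A nonzero remainder followed by zero digits only would be multiplied by \<open>\<beta>\<close> at each
  step and so exceed 1.\<close>

lemma beta_remainder_zero_iff:
  assumes "\<beta> > 1" "i > 0"
  shows "beta_remainder \<beta> i = 0 \<longleftrightarrow> (\<forall>n>i. beta_digit \<beta> n = 0)"
proof
  assume "beta_remainder \<beta> i = 0"
  then have "beta_remainder \<beta> (i + k) = 0" for k
    by (induction k) auto
  then have "beta_digit \<beta> (Suc (i + k)) = 0" for k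
    by (simp add: beta_digit_def)
  then show "\<forall>n>i. beta_digit \<beta> n = 0"
    by (metis less_iff_Suc_add)
next
  assume zero: "\<forall>n>i. beta_digit \<beta> n = 0"
  have growth: "beta_remainder \<beta> (i + k) = \<beta> ^ k * beta_remainder \<beta> i" for k
    using zero by (induction k) (simp_all add: beta_remainder_Suc[OF assms(1)] del: beta_remainder.simps)
  show "beta_remainder \<beta> i = 0"
  proof (rule ccontr)
    assume "beta_remainder \<beta> i \<noteq> 0"
    then have pos: "beta_remainder \<beta> i > 0" using beta_remainder_bounds(1)[of \<beta> i] by simp
    obtain k where "1 / beta_remainder \<beta> i < \<beta> ^ k"
      using real_arch_pow[OF assms(1)] by blast
    then have "1 < beta_remainder \<beta> (i + k)"
      using pos by (simp add: growth field_simps)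
    then show False using beta_remainder_bounds(2)[of \<beta> "i + k"] by simp
  qed
qed

text \<open>If the expansion is infinite, no remainder vanishes, and the greedy remainders serve. If it is
  finite of length \<open>m\<close>, the first vanishing remainder is \<open>r\<^sub>m\<close>; lowering the digit \<open>t\<^sub>m\<close>
  by one turns it into \<open>1 = r\<^sub>0\<close>, and the orbit \<open>r\<^sub>0, \<dots>, r\<^bsub>m-1\<^esub>\<close> repeats.\<close>

lemma quasi_greedy_remainders:
  assumes "\<beta> > 1"
  obtains q where "q 0 = 1" "\<And>i. 0 < q i" "\<And>i. q i \<le> 1"
    "\<And>i. q (Suc i) = \<beta> * q i - real (quasi_greedy_digit \<beta> (Suc i))"
proof (cases "finite_expansion (beta_digit \<beta>)")
  case False
  have "beta_remainder \<beta> i \<noteq> 0" for i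
    using False beta_remainder_zero_iff[OF assms, of i]
    by (cases "i = 0") (auto simp: finite_expansion_def)
  then have "0 < beta_remainder \<beta> i" for i
    using beta_remainder_bounds(1)[of \<beta> i] by (simp add: order_less_le)
  with False that[of "beta_remainder \<beta>"] beta_remainder_bounds(2) beta_remainder_Suc[OF assms]
  show thesis by (simp add: quasi_greedy_digit_def Let_def del: beta_remainder.simps(2))
next
  case True
  define t where "t = beta_digit \<beta>"
  define r where "r = beta_remainder \<beta>"
  define m where "m = expansion_length t"
  have fin: "\<exists>m. \<forall>n>m. t n = 0" using True by (simp add: finite_expansion_def t_def)
  have m: "\<forall>n>m. t n = 0"
    unfolding m_def expansion_length_def using fin by (rule LeastI_ex)
  have m_least: "\<not> (\<forall>n>i. t n = 0)" if "i < m" for i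
    using not_less_Least[of i "\<lambda>m. \<forall>n>m. t n = 0"] that by (simp add: m_def expansion_length_def)
  have "t 1 > 0"
    using assms by (simp add: t_def beta_digit_def)
  then have "m > 0" using m by (metis gr0I less_numeral_extra(1) less_numeral_extra(3))
  have r_m: "r m = 0"
    using beta_remainder_zero_iff[OF assms \<open>m > 0\<close>] m by (simp add: r_def t_def)
  have r_pos: "r i > 0" if "i < m" for i
  proof (cases "i = 0")
    case False
    then have "r i \<noteq> 0"
      using m_least[OF that] beta_remainder_zero_iff[OF assms, of i] by (simp add: r_def t_def)
    then show ?thesis using beta_remainder_bounds(1)[of \<beta> i] by (simp add: r_def)
  qed (simp add: r_def)
  have "t m \<noteq> 0"
  proof
    assume "t m = 0"
    moreover have "n = m \<or> n > m" if "n > m - 1" for n using that by auto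
    ultimately have "\<forall>n>m - 1. t n = 0" using m by blast
    then show False using m_least[of "m - 1"] \<open>m > 0\<close> by simp
  qed
  have digit: "quasi_greedy_digit \<beta> (Suc i)
      = (if Suc (i mod m) = m then t m - 1 else t (Suc (i mod m)))" for i
    using True by (simp add: quasi_greedy_digit_def Let_def flip: t_def m_def)
  have r_Suc: "r (Suc i) = \<beta> * r i - real (t (Suc i))" for i
    using beta_remainder_Suc[OF assms] by (simp add: r_def t_def)
  show thesis
  proof (rule that[of "\<lambda>i. r (i mod m)"])
    fix i
    show "0 < r (i mod m)" using r_pos \<open>m > 0\<close> by simp
    show "r (i mod m) \<le> 1" using beta_remainder_bounds(2) by (simp add: r_def)
    show "r (Suc i mod m) = \<beta> * r (i mod m) - real (quasi_greedy_digit \<beta> (Suc i))"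
    proof (cases "Suc (i mod m) = m")
      case True
      then have "\<beta> * r (i mod m) = real (t m)" using r_Suc[of "i mod m"] r_m by simp
      then show ?thesis using True \<open>t m \<noteq> 0\<close>
        by (simp add: digit mod_Suc of_nat_diff) (simp add: r_def)
    next
      case False
      then show ?thesis using r_Suc[of "i mod m"] by (simp add: digit mod_Suc)
    qed
  qed (simp add: r_def)
qed

section \<open>The carry propagation\<close>

theorem corollary5p34:
  fixes \<beta> :: real
  assumes "\<beta> > 1"
  shows "carry_propagation_exists (beta_word \<beta>) \<and>
         carry_propagation (beta_word \<beta>) = \<beta> / (\<beta> - 1)"
proof -
  obtain q where "q 0 = 1" "\<And>i. 0 < q i" "\<And>i. q i \<le> 1"
    "\<And>i. q (Suc i) = \<beta> * q i - real (quasi_greedy_digit \<beta> (Suc i))"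
    using quasi_greedy_remainders[OF assms] by blast
  then interpret quasi_greedy_basis \<beta> "\<lambda>i. quasi_greedy_digit \<beta> (Suc i)" q "canonical_basis \<beta>"
    using assms by unfold_locales simp_all
  have "carry_average (beta_word \<beta>) \<longlonglongrightarrow> \<beta> / (\<beta> - 1)"
    using carry_average_limit by (simp add: beta_word_def)
  then show ?thesis
    by (auto simp: carry_propagation_exists_def carry_propagation_def convergentI limI)
qed

end
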